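(* Let $S$ be a $(p,m,n)$ signed graph on a star $K_{1,k}$. Then $S$ is additively graceful if and only if $n=0$, or $n=1$, or $S$ is the path $P_3$ (on three vertices) both of whose edges are negative. Further, denote the central vertex by $z$, the negative edges by $u_iz$ ($i=1,\dots,n$) and the positive edges by $v_iz$ ($i=1,\dots,m$). Whenever $n=1$ or $n=2$, for each permissible value of $m$ (i.e. each $m$ for which $S$ is additively graceful) the additively graceful labeling of $S$ is unique up to rearrangement of labels among the $u_i$'s and among the $v_i$'s. When $n=0$, for each value of $m\geq 2$ there are exactly $2$ distinct additively graceful labelings of $S$, up to equivalence under complementary labelings and rearrangement of labels among the $u_i$'s and among the $v_i$'s.
   Context: A graph is finite, with nonempty vertex set, and its edges are unordered pairs of distinct vertices. A signed graph $S$ is a graph on $p$ vertices in which $m$ edges are specified as positive and the remaining $n$ edges are specified as negative; it is then called a $(p,m,n)$ signed graph, with sets of positive and negative edges $E^+(S)$ and $E^-(S)$. "A signed graph on $G$" means a signed graph whose underlying graph (ignoring signs) is $G$. A star is a complete bipartite graph $K_{1,k}$. An additively graceful labeling of a $(p,m,n)$ signed graph $S=(V,E)$ is an injective map $f:V\to\{0,1,\dots,m+\lceil\frac{n+1}{2}\rceil\}$ such that, with $f^*(uv)=f(u)+f(v)$ for $uv\in E^-(S)$ and $f^*(uv)=|f(u)-f(v)|$ for $uv\in E^+(S)$, one has $\{f^*(uv):uv\in E^-(S)\}=\{1,2,\dots,n\}$ and $\{f^*(uv):uv\in E^+(S)\}=\{1,2,\dots,m\}$. $S$ is additively graceful if it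 admits such a labeling. If $f$ is a vertex labeling (an injective map from the vertices to the integers) and $M$ is an upper bound for the values of $f$, then $M-f$ is the complementary labeling of $f$ with respect to $M$. Two labelings are equivalent under complementary labelings if one is the complementary labeling of the other with respect to some $M$; the count "up to equivalence" refers to the equivalence relation generated by these moves, together with rearrangement (permutation) of labels among the $u_i$'s and among the $v_i$'s.
   Formalization: For the single negative edge (n=1, m=0) the labels 0 and 1 can be exchanged, so uniqueness with z fixed fails; there the labeling is shown unique only up to also letting either end be named the central vertex. *)

theory Defs
  imports Complex_Main "HOL-Library.FuncSet"
begin

record 'a sgraph =
  verts :: "'a set"
  pos_edges :: "'a set set"
  neg_edges :: "'a set set"

definition edges :: "'a sgraph \<Rightarrow> 'a set set" where
  "edges S = pos_edges S \<union> neg_edges S"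

definition signed_graph :: "'a sgraph \<Rightarrow> bool" where
  "signed_graph S \<longleftrightarrow>
     finite (verts S) \<and> verts S \<noteq> {} \<and>
     (\<forall>e\<in>edges S. e \<subseteq> verts S \<and> card e = 2) \<and>
     pos_edges S \<inter> neg_edges S = {}"

definition pmn_signed_graph :: "'a sgraph \<Rightarrow> nat \<Rightarrow> nat \<Rightarrow> nat \<Rightarrow> bool" where
  "pmn_signed_graph S p m n \<longleftrightarrow>
     signed_graph S \<and> card (verts S) = p \<and> card (pos_edges S) = m \<and> card (neg_edges S) = n"

text \<open>The underlying graph is the complete bipartite graph with parts \<open>{z}\<close> and \<open>W\<close>,
  where \<open>W\<close> has \<open>k\<close> elements. The degenerate star with \<open>k = 0\<close> is included.\<close>

definition star_with_centre :: "'a sgraph \<Rightarrow> nat \<Rightarrow> 'a \<Rightarrow> bool" where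
  "star_with_centre S k z \<longleftrightarrow>
     (\<exists>W. z \<notin> W \<and> finite W \<and> card W = k \<and> verts S = insert z W \<and>
          edges S = {{z, w} | w. w \<in> W})"

text \<open>A star has exactly one centre unless it is a single edge, whose two ends are both
  centres in the above sense.\<close>

lemma star_centre_unique:
  assumes "star_with_centre S k z" "star_with_centre S k z'" "k \<noteq> 1"
  shows "z' = z"
proof (rule ccontr)
  assume ne: "z' \<noteq> z"
  from assms(1) obtain W where W: "card W = k" "verts S = insert z W"
      and E: "edges S = {{z, w} | w. w \<in> W}"
    unfolding star_with_centre_def by blast
  from assms(2) obtain W' where W': "verts S = insert z' W'"
      and E': "edges S = {{z', w} | w. w \<in> W'}"
    unfolding star_with_centre_def by blast
  have "w = z'" if "w \<in> W" for w
  proof -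
    have "{z, w} \<in> edges S" unfolding E using that by blast
    then have "z' \<in> {z, w}" unfolding E' by blast
    with ne show ?thesis by simp
  qed
  moreover have "z' \<in> W" using ne W(2) W' by blast
  ultimately have "W = {z'}" by blast
  with W(1) assms(3) show False by simp
qed

definition negative_P3 :: "'a sgraph \<Rightarrow> bool" where
  "negative_P3 S \<longleftrightarrow>
     (\<exists>a b c. a \<noteq> b \<and> b \<noteq> c \<and> a \<noteq> c \<and> verts S = {a, b, c} \<and>
        pos_edges S = {} \<and> neg_edges S = {{a, b}, {b, c}})"

text \<open>Labelings are extensional on the vertex set, so that two of them are equal as
  functions exactly when they agree on all vertices.\<close>

definition vertex_labelings :: "'a sgraph \<Rightarrow> ('a \<Rightarrow> int) set" where
  "vertex_labelings S = {f \<in> extensional (verts S). inj_on f (verts S)}"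

definition additively_graceful_labelings :: "'a sgraph \<Rightarrow> ('a \<Rightarrow> int) set" where
  "additively_graceful_labelings S =
     (let m = card (pos_edges S); n = card (neg_edges S) in
      {f \<in> vertex_labelings S.
         f ` verts S \<subseteq> {0 .. int m + \<lceil>(real n + 1) / 2\<rceil>} \<and>
         {f u + f v | u v. {u, v} \<in> neg_edges S} = {1 .. int n} \<and>
         {\<bar>f u - f v\<bar> | u v. {u, v} \<in> pos_edges S} = {1 .. int m}})"

definition additively_graceful :: "'a sgraph \<Rightarrow> bool" where
  "additively_graceful S \<longleftrightarrow> (\<exists>f. f \<in> additively_graceful_labelings S)"

definition pos_neighbours :: "'a sgraph \<Rightarrow> 'a \<Rightarrow> 'a set" where
  "pos_neighbours S z = {v. {v, z} \<in> pos_edges S}"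

definition neg_neighbours :: "'a sgraph \<Rightarrow> 'a \<Rightarrow> 'a set" where
  "neg_neighbours S z = {u. {u, z} \<in> neg_edges S}"

text \<open>\<open>g\<close> arises from \<open>f\<close> by permuting labels among the \<open>u\<^sub>i\<close> (negative neighbours of the
  centre) and among the \<open>v\<^sub>i\<close> (positive neighbours of the centre), where \<open>z\<close> is the vertex
  named as the centre for \<open>f\<close> and \<open>z'\<close> the one named as the centre for \<open>g\<close>. These
  can differ only if the star is a single edge.\<close>

definition rearranged :: "'a sgraph \<Rightarrow> 'a \<Rightarrow> ('a \<Rightarrow> int) \<Rightarrow> 'a \<Rightarrow> ('a \<Rightarrow> int) \<Rightarrow> bool" where
  "rearranged S z f z' g \<longleftrightarrow>
     (\<exists>\<pi>. bij_betw \<pi> (verts S) (verts S) \<and> \<pi> z = z' \<and>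
          bij_betw \<pi> (neg_neighbours S z) (neg_neighbours S z') \<and>
          bij_betw \<pi> (pos_neighbours S z) (pos_neighbours S z') \<and>
          (\<forall>v\<in>verts S. g (\<pi> v) = f v))"

definition complementary_labeling :: "'a sgraph \<Rightarrow> int \<Rightarrow> ('a \<Rightarrow> int) \<Rightarrow> 'a \<Rightarrow> int" where
  "complementary_labeling S M f = (\<lambda>v\<in>verts S. M - f v)"

definition labeling_moves :: "'a sgraph \<Rightarrow> 'a \<Rightarrow> (('a \<Rightarrow> int) \<times> ('a \<Rightarrow> int)) set" where
  "labeling_moves S z =
     {(f, g). f \<in> vertex_labelings S \<and> g \<in> vertex_labelings S \<and>
        ((\<exists>M. (\<forall>v\<in>verts S. f v \<le> M) \<and> g = complementary_labeling S M f) \<or>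
         rearranged S z f z g)}"

definition labeling_equiv :: "'a sgraph \<Rightarrow> 'a \<Rightarrow> (('a \<Rightarrow> int) \<times> ('a \<Rightarrow> int)) set" where
  "labeling_equiv S z = (labeling_moves S z \<union> (labeling_moves S z)\<inverse>)\<^sup>*"

end

theory Submission
  imports Defs
begin

text \<open>
  Everything happens at the centre \<open>z\<close>. Every edge of a star contains \<open>z\<close>, so once \<open>c = f z\<close> is
  known, the edge labels \<open>1, \<dots>, n\<close> and \<open>1, \<dots>, m\<close> dictate the leaf labels: the negative leaves
  carry exactly \<open>d - c\<close> for \<open>1 \<le> d \<le> n\<close>, and for every \<open>1 \<le> d \<le> m\<close> there is one positive leaf
  with label \<open>c + d\<close> or \<open>c - d\<close>. What remains is to see which \<open>c\<close> keep all of these distinct and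
  inside the allowed interval.

  If \<open>n \<ge> 1\<close>, the edge sum \<open>1\<close> forces \<open>c \<in> {0, 1}\<close>.
  For \<open>n \<ge> 2\<close> the edge sum \<open>2\<close> rules out \<open>c = 1\<close>, which would give a leaf the label of the
  centre. So \<open>c = 0\<close>, the negative leaves
  carry \<open>1, \<dots>, n\<close>, a positive leaf would have to share the label \<open>1\<close>, and without positive edges
  the largest allowed label is \<open>\<lceil>(n + 1) / 2\<rceil>\<close>, which is below \<open>n\<close> as soon as \<open>n \<ge> 3\<close>
  (\<open>graceful_two_neg\<close>). For \<open>n = 1\<close> and \<open>m \<ge> 1\<close> a positive leaf excludes \<open>c = 0\<close> for the same
  reason, and \<open>c = 1\<close> leaves one possibility (\<open>graceful_one_neg\<close>). If \<open>n = 1\<close> and \<open>m = 0\<close>, the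
  star is a single edge and the two labelings differ by the exchange of its ends.

  If \<open>n = 0\<close> and \<open>m \<ge> 2\<close>, the labels lie in \<open>{0..m + 1}\<close>, and the edge label \<open>m\<close> leaves only \<open>c \<le> 1\<close> or
  \<open>c \<ge> m\<close>. Complementation with respect to \<open>m + 1\<close> exchanges the two ranges. In the first range the
  possible pairs of \<open>c\<close> and the set of leaf labels are \<open>0\<close> with \<open>{1..m}\<close>, its translate \<open>1\<close> with
  \<open>{2..m + 1}\<close>, and \<open>1\<close> with \<open>{0} \<union> {3..m + 1}\<close>. Two successive complementations are a
  translation, so the first two are equivalent. The third is not equivalent to them, because
  whether the centre has an extreme label is invariant under complementation and rearrangement.
\<close>

section \<open>Signed stars\<close>

locale signed_star =
  fixes S :: "'a sgraph" and z :: 'a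
  assumes finite_verts: "finite (verts S)"
    and verts_eq: "verts S = insert z (pos_neighbours S z \<union> neg_neighbours S z)"
    and centre_notin: "z \<notin> pos_neighbours S z" "z \<notin> neg_neighbours S z"
    and neighbours_disjoint: "pos_neighbours S z \<inter> neg_neighbours S z = {}"
    and pos_edges_eq: "pos_edges S = (\<lambda>v. {v, z}) ` pos_neighbours S z"
    and neg_edges_eq: "neg_edges S = (\<lambda>v. {v, z}) ` neg_neighbours S z"
begin

abbreviation "P \<equiv> pos_neighbours S z"
abbreviation "N \<equiv> neg_neighbours S z"

lemma finite_neighbours [simp]: "finite P" "finite N"
  using finite_verts unfolding verts_eq by auto

lemma card_pos_edges: "card (pos_edges S) = card P"
  unfolding pos_edges_eq by (rule card_image) (auto simp: inj_on_def doubleton_eq_iff)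

lemma card_neg_edges: "card (neg_edges S) = card N"
  unfolding neg_edges_eq by (rule card_image) (auto simp: inj_on_def doubleton_eq_iff)

lemma neg_neighbours_empty: "card N = 0 \<Longrightarrow> N = {}"
  by simp

end

lemma signed_star_of_star_with_centre:
  assumes "signed_graph S" and "star_with_centre S k z"
  shows "signed_star S z"
    and "k = card (pos_neighbours S z) + card (neg_neighbours S z)"
proof -
  obtain W where W: "z \<notin> W" "finite W" "card W = k" "verts S = insert z W"
    and E: "edges S = {{z, w} | w. w \<in> W}"
    using assms(2) unfolding star_with_centre_def by blast
  have disj: "pos_edges S \<inter> neg_edges S = {}" and fin: "finite (verts S)"
    using assms(1) unfolding signed_graph_def by auto
  have leaf: "{v, z} \<in> edges S \<longleftrightarrow> v \<in> W" for v
    unfolding E using W(1) by (auto simp: doubleton_eq_iff)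
  have W_eq: "pos_neighbours S z \<union> neg_neighbours S z = W"
    using leaf unfolding pos_neighbours_def neg_neighbours_def edges_def by auto
  have disj': "pos_neighbours S z \<inter> neg_neighbours S z = {}"
    using disj unfolding pos_neighbours_def neg_neighbours_def by auto
  have edge: "\<exists>v. e = {v, z}" if "e \<in> edges S" for e
    using that unfolding E by (auto simp: insert_commute)
  show "signed_star S z"
  proof
    show "finite (verts S)" by (rule fin)
    show "verts S = insert z (pos_neighbours S z \<union> neg_neighbours S z)"
      unfolding W_eq by (rule W(4))
    show "z \<notin> pos_neighbours S z" "z \<notin> neg_neighbours S z"
      using W(1) W_eq by auto
    show "pos_neighbours S z \<inter> neg_neighbours S z = {}" by (rule disj')
    show "pos_edges S = (\<lambda>v. {v, z}) ` pos_neighbours S z"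
      using edge unfolding pos_neighbours_def edges_def by fastforce
    show "neg_edges S = (\<lambda>v. {v, z}) ` neg_neighbours S z"
      using edge unfolding neg_neighbours_def edges_def by fastforce
  qed
  have "finite (pos_neighbours S z \<union> neg_neighbours S z)"
    unfolding W_eq by (rule W(2))
  then show "k = card (pos_neighbours S z) + card (neg_neighbours S z)"
    unfolding W(3)[symmetric] W_eq[symmetric] using card_Un_disjoint[OF _ _ disj'] by simp
qed

lemma edge_labels_at_centre:
  assumes sym: "\<And>x y. h x y = h y x"
  shows "{h u v | u v. {u, v} \<in> (\<lambda>v. {v, z}) ` A} = (\<lambda>v. h v z) ` A"
proof
  show "{h u v | u v. {u, v} \<in> (\<lambda>v. {v, z}) ` A} \<subseteq> (\<lambda>v. h v z) ` A"
    by (auto simp: doubleton_eq_iff sym[of z])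
  show "(\<lambda>v. h v z) ` A \<subseteq> {h u v | u v. {u, v} \<in> (\<lambda>v. {v, z}) ` A}"
    by blast
qed

context signed_star
begin

lemma graceful_iff:
  "f \<in> additively_graceful_labelings S \<longleftrightarrow>
     f \<in> vertex_labelings S \<and>
     f ` verts S \<subseteq> {0 .. int (card P) + \<lceil>(real (card N) + 1) / 2\<rceil>} \<and>
     (\<lambda>u. f u + f z) ` N = {1 .. int (card N)} \<and>
     (\<lambda>v. \<bar>f v - f z\<bar>) ` P = {1 .. int (card P)}"
proof -
  have "{f u + f v | u v. {u, v} \<in> neg_edges S} = (\<lambda>u. f u + f z) ` N"
    unfolding neg_edges_eq by (rule edge_labels_at_centre) simp
  moreover have "{\<bar>f u - f v\<bar> | u v. {u, v} \<in> pos_edges S} = (\<lambda>v. \<bar>f v - f z\<bar>) ` P"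
    unfolding pos_edges_eq by (rule edge_labels_at_centre) (simp add: abs_minus_commute)
  ultimately show ?thesis
    unfolding additively_graceful_labelings_def Let_def card_pos_edges card_neg_edges by simp
qed

lemma vertex_labeling_leaf_neq_centre:
  "f \<in> vertex_labelings S \<Longrightarrow> v \<in> P \<union> N \<Longrightarrow> f v \<noteq> f z"
  using centre_notin unfolding vertex_labelings_def verts_eq inj_on_def by auto

lemma vertex_labeling_images_disjoint:
  "f \<in> vertex_labelings S \<Longrightarrow> f ` P \<inter> f ` N = {}"
  using neighbours_disjoint unfolding vertex_labelings_def verts_eq inj_on_def by fastforce

lemma card_image_pos_neighbours:
  "f \<in> vertex_labelings S \<Longrightarrow> card (f ` P) = card P"
  unfolding vertex_labelings_def verts_eq
  by (auto intro!: card_image elim: inj_on_subset)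

text \<open>Because leaves of the same sign are interchangeable, a labeling matters only through the
  label of the centre and the two sets of leaf labels.\<close>

lemma rearranged_if_same_labels:
  assumes f: "f \<in> vertex_labelings S" and g: "g \<in> vertex_labelings S"
    and "f z = g z" "f ` P = g ` P" "f ` N = g ` N"
  shows "rearranged S z f z g"
proof -
  define \<pi> where "\<pi> = (\<lambda>v. the_inv_into (verts S) g (f v))"
  have injf: "inj_on f (verts S)" and injg: "inj_on g (verts S)"
    using f g unfolding vertex_labelings_def by auto
  have restrict: "bij_betw \<pi> A A" if "f ` A = g ` A" "A \<subseteq> verts S" for A
  proof -
    have "inj_on \<pi> A"
    proof (rule inj_onI)
      fix x y assume xy: "x \<in> A" "y \<in> A" "\<pi> x = \<pi> y"
      have "f x \<in> g ` verts S" "f y \<in> g ` verts S"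
        using xy that by (metis image_eqI image_mono subsetD)+
      then have "f x = f y"
        using xy(3) f_the_inv_into_f[OF injg] unfolding \<pi>_def by metis
      then show "x = y" using injf xy that(2) by (meson inj_onD subsetD)
    qed
    moreover have "\<pi> ` A = the_inv_into (verts S) g ` g ` A"
      unfolding \<pi>_def that(1)[symmetric] by (simp add: image_image)
    then have "\<pi> ` A = A"
      using the_inv_into_f_f[OF injg] that(2) by (force simp: image_image subset_iff)
    ultimately show ?thesis unfolding bij_betw_def by simp
  qed
  have all: "f ` verts S = g ` verts S"
    unfolding verts_eq using assms(3-5) by (simp add: image_Un)
  have "\<pi> z = z"
    unfolding \<pi>_def \<open>f z = g z\<close> by (rule the_inv_into_f_f[OF injg]) (simp add: verts_eq)
  moreover have "g (\<pi> v) = f v" if "v \<in> verts S" for v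
    unfolding \<pi>_def using that all by (intro f_the_inv_into_f[OF injg]) auto
  moreover have "bij_betw \<pi> (verts S) (verts S)" "bij_betw \<pi> P P" "bij_betw \<pi> N N"
    using all assms(4,5) verts_eq by (auto intro!: restrict)
  ultimately show ?thesis unfolding rearranged_def by blast
qed

lemma exists_vertex_labeling:
  assumes "finite A" "card A = card P" "finite B" "card B = card N"
    and "A \<inter> B = {}" "c \<notin> A" "c \<notin> B"
  obtains f where "f \<in> vertex_labelings S" "f z = c" "f ` P = A" "f ` N = B"
proof -
  obtain a b where a: "bij_betw a P A" and b: "bij_betw b N B"
    using assms finite_neighbours finite_same_card_bij by metis
  define f where "f = (\<lambda>v\<in>verts S. if v = z then c else if v \<in> P then a v else b v)"
  have fP: "f v = a v" if "v \<in> P" for v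
    using that centre_notin unfolding f_def verts_eq by auto
  have fN: "f v = b v" if "v \<in> N" for v
    using that centre_notin neighbours_disjoint unfolding f_def verts_eq by auto
  have fz: "f z = c" unfolding f_def verts_eq by simp
  have imP: "f ` P = A" using a fP unfolding bij_betw_def by (metis image_cong)
  have imN: "f ` N = B" using b fN unfolding bij_betw_def by (metis image_cong)
  have "inj_on f P" using a fP unfolding bij_betw_def by (metis inj_on_cong)
  moreover have "inj_on f N" using b fN unfolding bij_betw_def by (metis inj_on_cong)
  ultimately have "inj_on f (P \<union> N)"
    using assms(5) imP imN by (auto simp: inj_on_Un)
  then have "inj_on f (verts S)"
    unfolding verts_eq using centre_notin assms(6,7) fz imP imN by auto
  moreover have "f \<in> extensional (verts S)" unfolding f_def by simp
  ultimately have "f \<in> vertex_labelings S" unfolding vertex_labelings_def by simp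
  then show ?thesis using that fz imP imN by blast
qed

section \<open>Stars with a negative edge\<close>

lemma graceful_two_neg:
  assumes f: "f \<in> additively_graceful_labelings S" and "card N \<ge> 2"
  shows "card N = 2 \<and> P = {} \<and> f z = 0 \<and> f ` N = {1, 2}"
proof -
  have vl: "f \<in> vertex_labelings S"
    and bnd: "f ` verts S \<subseteq> {0 .. int (card P) + \<lceil>(real (card N) + 1) / 2\<rceil>}"
    and neg: "(\<lambda>u. f u + f z) ` N = {1 .. int (card N)}"
    and pos: "(\<lambda>v. \<bar>f v - f z\<bar>) ` P = {1 .. int (card P)}"
    using f graceful_iff by auto
  have nonneg: "f v \<ge> 0" if "v \<in> verts S" for v using bnd that by auto
  have "1 \<in> (\<lambda>u. f u + f z) ` N" unfolding neg using assms(2) by simp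
  then obtain u1 where u1: "u1 \<in> N" "1 = f u1 + f z" by (rule imageE)
  have "2 \<in> (\<lambda>u. f u + f z) ` N" unfolding neg using assms(2) by simp
  then obtain u2 where u2: "u2 \<in> N" "2 = f u2 + f z" by (rule imageE)
  have "f z \<ge> 0" "f u1 \<ge> 0" using nonneg u1 verts_eq by auto
  moreover have "f u2 \<noteq> f z" using vertex_labeling_leaf_neq_centre[OF vl] u2 by auto
  ultimately have z0: "f z = 0" using u1 u2 by linarith
  have im: "f ` N = {1 .. int (card N)}" using neg z0 by simp
  have "P = {}"
  proof (rule ccontr)
    assume "P \<noteq> {}"
    then have "1 \<in> (\<lambda>v. \<bar>f v - f z\<bar>) ` P"
      unfolding pos using card_gt_0_iff[of P] by auto
    then obtain v where v: "v \<in> P" "1 = \<bar>f v - f z\<bar>" by (rule imageE)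
    then have "f v = 1" using nonneg[of v] z0 verts_eq by auto
    moreover have "1 \<in> f ` N" unfolding im using assms(2) by simp
    ultimately show False using vertex_labeling_images_disjoint[OF vl] v by auto
  qed
  have "int (card N) \<in> f ` verts S"
    using im assms(2) unfolding verts_eq by auto
  then have "int (card N) \<le> \<lceil>(real (card N) + 1) / 2\<rceil>" using bnd \<open>P = {}\<close> by auto
  then have "card N \<le> 2" by (simp add: le_ceiling_iff)
  then have "card N = 2" using assms(2) by simp
  moreover have "{1 .. 2} = {1, 2 :: int}" by auto
  ultimately show ?thesis using \<open>P = {}\<close> z0 im by simp
qed

lemma graceful_one_neg:
  assumes f: "f \<in> additively_graceful_labelings S" and N: "card N = 1" and "P \<noteq> {}"
  shows "f z = 1 \<and> f ` N = {0} \<and> f ` P = {2 .. int (card P) + 1}"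
proof -
  have vl: "f \<in> vertex_labelings S"
    and bnd: "f ` verts S \<subseteq> {0 .. int (card P) + \<lceil>(real (card N) + 1) / 2\<rceil>}"
    and neg: "(\<lambda>u. f u + f z) ` N = {1 .. int (card N)}"
    and pos: "(\<lambda>v. \<bar>f v - f z\<bar>) ` P = {1 .. int (card P)}"
    using f graceful_iff by auto
  have nonneg: "f v \<ge> 0" if "v \<in> verts S" for v using bnd that by auto
  obtain u where u: "N = {u}" using N card_1_singletonE by blast
  have sum: "f u + f z = 1" using neg unfolding u by simp
  have ge: "f u \<ge> 0" "f z \<ge> 0" using nonneg u verts_eq by auto
  have fresh: "f v \<noteq> f u" "f v \<noteq> f z" "f v \<ge> 0" if "v \<in> P" for v
  proof -
    have "f u \<notin> f ` P" using vertex_labeling_images_disjoint[OF vl] u by simp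
    then show "f v \<noteq> f u" using that by (metis imageI)
    show "f v \<noteq> f z" using vertex_labeling_leaf_neq_centre[OF vl] that by simp
    show "f v \<ge> 0" using nonneg that verts_eq by simp
  qed
  have "1 \<in> (\<lambda>v. \<bar>f v - f z\<bar>) ` P"
    unfolding pos using \<open>P \<noteq> {}\<close> card_gt_0_iff[of P] by auto
  then obtain v where v: "v \<in> P" "1 = \<bar>f v - f z\<bar>" by (rule imageE)
  \<comment> \<open>With centre label \<open>0\<close> both \<open>u\<close> and \<open>v\<close> would be labelled \<open>1\<close>.\<close>
  have z1: "f z = 1" using v fresh[OF v(1)] sum ge by linarith
  have "f x = \<bar>f x - f z\<bar> + 1" if "x \<in> P" for x
    using fresh[OF that] sum z1 by linarith
  then have "f ` P = (\<lambda>d. d + 1) ` (\<lambda>v. \<bar>f v - f z\<bar>) ` P"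
    by (simp add: image_image cong: image_cong)
  also have "\<dots> = {2 .. int (card P) + 1}"
    unfolding pos by (subst image_add_atLeastAtMost') simp
  finally show ?thesis using z1 sum u by simp
qed

lemma exists_graceful_one_neg:
  assumes "card N = 1"
  shows "additively_graceful S"
proof -
  obtain f where f: "f \<in> vertex_labelings S" "f z = 1" "f ` P = {2 .. int (card P) + 1}"
    "f ` N = {0}"
    using exists_vertex_labeling[of "{2 .. int (card P) + 1}" "{0}" 1] assms by auto
  have "(\<lambda>v. \<bar>f v - f z\<bar>) ` P = (\<lambda>x. \<bar>x - 1\<bar>) ` f ` P"
    by (simp add: image_image f(2))
  also have "\<dots> = (\<lambda>x. x - 1) ` {2 .. int (card P) + 1}"
    unfolding f(3) by (rule image_cong) auto
  also have "\<dots> = {1 .. int (card P)}" by simp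
  finally have pos: "(\<lambda>v. \<bar>f v - f z\<bar>) ` P = {1 .. int (card P)}" .
  have "(\<lambda>u. f u + f z) ` N = (\<lambda>x. x + 1) ` f ` N"
    by (simp add: image_image f(2))
  then have neg: "(\<lambda>u. f u + f z) ` N = {1 .. int (card N)}" using f(4) assms by simp
  have "f ` verts S \<subseteq> {0 .. int (card P) + 1}"
    unfolding verts_eq using f by (auto simp: image_Un)
  then have "f \<in> additively_graceful_labelings S"
    using f(1) pos neg assms graceful_iff by simp
  then show ?thesis unfolding additively_graceful_def by blast
qed

lemma exists_graceful_two_neg:
  assumes "card N = 2" and P: "P = {}"
  shows "additively_graceful S"
proof -
  obtain f where f: "f \<in> vertex_labelings S" "f z = 0" "f ` P = {}" "f ` N = {1, 2}"
    using exists_vertex_labeling[of "{}" "{1, 2}" 0] assms by auto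
  have "(\<lambda>u. f u + f z) ` N = {1 .. int (card N)}" using f(2,4) assms by auto
  moreover have "f ` verts S \<subseteq> {0 .. 2}" unfolding verts_eq using f by (auto simp: image_Un)
  moreover have "\<lceil>(real (card N) + 1) / 2\<rceil> = 2" using assms(1) by (simp add: ceiling_eq_iff)
  ultimately have "f \<in> additively_graceful_labelings S"
    using f(1) P graceful_iff by simp
  then show ?thesis unfolding additively_graceful_def by blast
qed

lemma negative_P3_iff: "negative_P3 S \<longleftrightarrow> card N = 2 \<and> P = {}"
proof
  assume "negative_P3 S"
  then obtain a b c where abc: "a \<noteq> b" "b \<noteq> c" "a \<noteq> c"
    and E: "pos_edges S = {}" "neg_edges S = {{a, b}, {b, c}}"
    unfolding negative_P3_def by blast
  have "{a, b} \<noteq> {b, c}" using abc by (auto simp: doubleton_eq_iff)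
  then have "card (neg_edges S) = 2" unfolding E(2) by simp
  then show "card N = 2 \<and> P = {}"
    using card_neg_edges pos_edges_eq E(1) by auto
next
  assume *: "card N = 2 \<and> P = {}"
  then obtain a c where N: "N = {a, c}" "a \<noteq> c" by (auto simp: card_2_iff)
  have "a \<noteq> z" "z \<noteq> c" using centre_notin N by auto
  moreover have "verts S = {a, z, c}" using verts_eq N * by auto
  moreover have "neg_edges S = {{a, z}, {z, c}}"
    unfolding neg_edges_eq N by (auto simp: insert_commute)
  moreover have "pos_edges S = {}" using pos_edges_eq * by simp
  ultimately show "negative_P3 S" unfolding negative_P3_def using N(2) by blast
qed

text \<open>The single negative edge is the one case in which the rearrangement may have to rename
  the centre: its labels \<open>0\<close> and \<open>1\<close> can be exchanged.\<close>

lemma single_negative_edge_labelings_rearranged: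
  assumes f: "f \<in> additively_graceful_labelings S"
    and g: "g \<in> additively_graceful_labelings S"
    and N: "card N = 1" and P: "P = {}"
  shows "\<exists>z'. star_with_centre S 1 z' \<and> rearranged S z f z' g"
proof -
  obtain u where u: "N = {u}" using N card_1_singletonE by blast
  have uz: "u \<noteq> z" using u centre_notin by auto
  have V: "verts S = {z, u}" using verts_eq u P by simp
  have E: "pos_edges S = {}" "neg_edges S = {{u, z}}"
    using pos_edges_eq neg_edges_eq u P by auto
  have star: "star_with_centre S 1 z" "star_with_centre S 1 u"
    unfolding star_with_centre_def edges_def E V using uz
    by (auto intro: exI[of _ "{u}"] exI[of _ "{z}"])
  have vl: "f \<in> vertex_labelings S" "g \<in> vertex_labelings S"
    using f g graceful_iff by auto
  have sum: "h u + h z = 1 \<and> 0 \<le> h u \<and> 0 \<le> h z"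
    if "h \<in> additively_graceful_labelings S" for h
    using that u P V N unfolding graceful_iff by auto
  show ?thesis
  proof (cases "f z = g z")
    case True
    then have "f ` N = g ` N" using sum[OF f] sum[OF g] u by simp
    then have "rearranged S z f z g"
      using rearranged_if_same_labels[OF vl True] P by simp
    then show ?thesis using star by blast
  next
    case False
    then have swap: "g u = f z" "g z = f u" using sum[OF f] sum[OF g] by linarith+
    define \<pi> where "\<pi> = (\<lambda>x. if x = z then u else z)"
    have "pos_neighbours S u = {}" "neg_neighbours S u = {z}"
      unfolding pos_neighbours_def neg_neighbours_def E using uz
      by (auto simp: doubleton_eq_iff)
    then have "bij_betw \<pi> (verts S) (verts S)" "bij_betw \<pi> N (neg_neighbours S u)"
      "bij_betw \<pi> P (pos_neighbours S u)"
      using uz unfolding V u P \<pi>_def bij_betw_def by (auto simp: inj_on_def)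
    then have "rearranged S z f u g"
      unfolding rearranged_def using swap uz unfolding V
      by (intro exI[of _ \<pi>]) (auto simp: \<pi>_def)
    then show ?thesis using star by blast
  qed
qed

section \<open>Equivalence of labelings\<close>

lemma complementary_in_vertex_labelings:
  "f \<in> vertex_labelings S \<Longrightarrow> complementary_labeling S M f \<in> vertex_labelings S"
  unfolding vertex_labelings_def complementary_labeling_def by (auto simp: inj_on_def)

lemma complementary_equiv:
  assumes "f \<in> vertex_labelings S" "\<And>v. v \<in> verts S \<Longrightarrow> f v \<le> M"
  shows "(f, complementary_labeling S M f) \<in> labeling_equiv S z"
  using assms complementary_in_vertex_labelings[OF assms(1)]
  unfolding labeling_equiv_def labeling_moves_def by blast

lemma same_labels_equiv:
  assumes "f \<in> vertex_labelings S" "g \<in> vertex_labelings S"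
    and "f z = g z" "f ` P = g ` P" "N = {}"
  shows "(f, g) \<in> labeling_equiv S z"
  using assms rearranged_if_same_labels[OF assms(1-4)]
  unfolding labeling_equiv_def labeling_moves_def by blast

end

lemma equiv_labeling_equiv: "equiv UNIV (labeling_equiv S z)"
  unfolding labeling_equiv_def equiv_def
  by (auto simp: refl_rtrancl trans_rtrancl intro!: sym_rtrancl sym_Un_converse)

definition extreme_centre :: "'a sgraph \<Rightarrow> 'a \<Rightarrow> ('a \<Rightarrow> int) \<Rightarrow> bool" where
  "extreme_centre S z f \<longleftrightarrow> (\<forall>v\<in>verts S. f z \<le> f v) \<or> (\<forall>v\<in>verts S. f v \<le> f z)"

context signed_star
begin

text \<open>Complementation exchanges minimum and maximum, and a rearrangement fixes the centre and
  the set of all labels.\<close>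

lemma extreme_centre_move:
  assumes "(f, g) \<in> labeling_moves S z"
  shows "extreme_centre S z f \<longleftrightarrow> extreme_centre S z g"
proof -
  have z: "z \<in> verts S" using verts_eq by simp
  consider M where "g = complementary_labeling S M f" | "rearranged S z f z g"
    using assms unfolding labeling_moves_def by blast
  then show ?thesis
  proof cases
    case 1
    then show ?thesis
      using z unfolding extreme_centre_def complementary_labeling_def by auto
  next
    case 2
    then obtain \<pi> where \<pi>: "bij_betw \<pi> (verts S) (verts S)" "\<pi> z = z"
      "\<And>v. v \<in> verts S \<Longrightarrow> g (\<pi> v) = f v"
      unfolding rearranged_def by blast
    have same: "(\<forall>v\<in>verts S. Q (g v)) \<longleftrightarrow> (\<forall>v\<in>verts S. Q (f v))" for Q
    proof -
      have "g ` verts S = g ` \<pi> ` verts S" using \<pi>(1) unfolding bij_betw_def by simp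
      also have "\<dots> = f ` verts S" using \<pi>(3) by (simp add: image_image)
      finally show ?thesis by (metis imageE imageI)
    qed
    have "g z = f z" using \<pi>(2,3) z by metis
    then show ?thesis
      unfolding extreme_centre_def
      using same[of "\<lambda>x. f z \<le> x"] same[of "\<lambda>x. x \<le> f z"] by simp
  qed
qed

lemma extreme_centre_equiv:
  assumes "(f, g) \<in> labeling_equiv S z"
  shows "extreme_centre S z f \<longleftrightarrow> extreme_centre S z g"
  using assms unfolding labeling_equiv_def
  by (induction rule: rtrancl_induct) (use extreme_centre_move in blast)+

section \<open>Stars without negative edges\<close>

lemma graceful_no_neg_iff:
  assumes "N = {}"
  shows "f \<in> additively_graceful_labelings S \<longleftrightarrow>
     f \<in> vertex_labelings S \<and> f ` verts S \<subseteq> {0 .. int (card P) + 1} \<and>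
     (\<lambda>v. \<bar>f v - f z\<bar>) ` P = {1 .. int (card P)}"
proof -
  have "\<lceil>(1::real) / 2\<rceil> = 1" by (simp add: ceiling_eq_iff)
  then show ?thesis using graceful_iff assms by simp
qed

lemma exists_graceful_minimal_centre:
  assumes N: "N = {}"
  obtains f where "f \<in> additively_graceful_labelings S" "f z = 0"
    "f ` P = {1 .. int (card P)}" "extreme_centre S z f"
proof -
  obtain f where f: "f \<in> vertex_labelings S" "f z = 0" "f ` P = {1 .. int (card P)}"
    using exists_vertex_labeling[of "{1 .. int (card P)}" "{}" 0] N by auto
  have "(\<lambda>v. \<bar>f v - f z\<bar>) ` P = abs ` f ` P" by (simp add: image_image f(2))
  also have "\<dots> = {1 .. int (card P)}" unfolding f(3) by force
  finally have "f \<in> additively_graceful_labelings S"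
    unfolding graceful_no_neg_iff[OF N] using f verts_eq N by (auto simp: image_Un)
  moreover have "0 \<le> f v" if "v \<in> P" for v
    using f(3) that by (metis atLeastAtMost_iff imageI order_trans zero_le_one)
  then have "extreme_centre S z f"
    unfolding extreme_centre_def verts_eq N using f(2) by auto
  ultimately show ?thesis using that f by blast
qed

lemma exists_graceful_interior_centre:
  assumes N: "N = {}" and P: "card P \<ge> 2"
  obtains f where "f \<in> additively_graceful_labelings S" "f z = 1"
    "f ` P = insert 0 {3 .. int (card P) + 1}" "\<not> extreme_centre S z f"
proof -
  have "card (insert 0 {3 .. int (card P) + 1}) = card P" using P by simp
  then obtain f where f: "f \<in> vertex_labelings S" "f z = 1"
    "f ` P = insert 0 {3 .. int (card P) + 1}"
    using exists_vertex_labeling[of "insert 0 {3 .. int (card P) + 1}" "{}" 1] N by auto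
  have "(\<lambda>v. \<bar>f v - f z\<bar>) ` P = (\<lambda>x. \<bar>x - 1\<bar>) ` f ` P" by (simp add: image_image f(2))
  also have "\<dots> = insert 1 ((\<lambda>x. x - 1) ` {3 .. int (card P) + 1})"
    unfolding f(3) by (auto intro!: image_cong)
  also have "\<dots> = {1 .. int (card P)}" using P by auto
  finally have "f \<in> additively_graceful_labelings S"
    unfolding graceful_no_neg_iff[OF N] using f verts_eq N by (auto simp: image_Un)
  moreover have "0 \<in> f ` P" "3 \<in> f ` P" unfolding f(3) using P by auto
  then obtain x y where "x \<in> P" "f x = 0" "y \<in> P" "f y = 3" by (metis imageE)
  then have "\<not> extreme_centre S z f"
    unfolding extreme_centre_def verts_eq N using f(2) by force
  ultimately show ?thesis using that f by blast
qed

text \<open>The edge label \<open>m\<close> occurs within \<open>{0..m + 1}\<close> only if the centre is within distance \<open>1\<close> of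
  one end of this interval. Complementation with respect to \<open>m + 1\<close> reflects the interval.\<close>

lemma graceful_no_neg_equiv_low_centre:
  assumes N: "N = {}" and P: "card P \<ge> 1" and f: "f \<in> additively_graceful_labelings S"
  obtains g where "g \<in> additively_graceful_labelings S" "(f, g) \<in> labeling_equiv S z" "g z \<le> 1"
proof (cases "f z \<le> 1")
  case True
  moreover have "(f, f) \<in> labeling_equiv S z" unfolding labeling_equiv_def by simp
  ultimately show ?thesis using that f by blast
next
  case False
  have vl: "f \<in> vertex_labelings S"
    and bnd: "f ` verts S \<subseteq> {0 .. int (card P) + 1}"
    and pos: "(\<lambda>v. \<bar>f v - f z\<bar>) ` P = {1 .. int (card P)}"
    using f graceful_no_neg_iff[OF N] by auto
  have "int (card P) \<in> (\<lambda>v. \<bar>f v - f z\<bar>) ` P" unfolding pos using P by auto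
  then obtain v where v: "v \<in> P" "int (card P) = \<bar>f v - f z\<bar>" by (rule imageE)
  have "f v \<in> {0 .. int (card P) + 1}" using bnd v(1) verts_eq by blast
  then have high: "f z \<ge> int (card P)" using v(2) False by auto
  define g where "g = complementary_labeling S (int (card P) + 1) f"
  have g: "g v = int (card P) + 1 - f v" if "v \<in> verts S" for v
    using that unfolding g_def complementary_labeling_def by simp
  have "g z \<le> 1" using g[of z] high verts_eq by simp
  moreover have "(f, g) \<in> labeling_equiv S z"
    unfolding g_def using bnd by (intro complementary_equiv[OF vl]) auto
  moreover have "(\<lambda>v. \<bar>g v - g z\<bar>) ` P = (\<lambda>v. \<bar>f v - f z\<bar>) ` P"
    using g verts_eq by (intro image_cong) auto
  then have "g \<in> additively_graceful_labelings S"
    unfolding graceful_no_neg_iff[OF N] using pos bnd g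
      complementary_in_vertex_labelings[OF vl, of "int (card P) + 1"]
    by (auto simp: g_def[symmetric] image_subset_iff)
  ultimately show ?thesis using that by blast
qed

lemma graceful_low_centre_cases:
  assumes N: "N = {}" and P: "card P \<ge> 2"
    and f: "f \<in> additively_graceful_labelings S" and low: "f z \<le> 1"
  obtains (minimal) "f ` P = {f z + 1 .. f z + int (card P)}" "f z = 0 \<or> f z = 1"
    | (interior) "f z = 1" "f ` P = insert 0 {3 .. int (card P) + 1}"
proof -
  have vl: "f \<in> vertex_labelings S"
    and bnd: "f ` verts S \<subseteq> {0 .. int (card P) + 1}"
    and pos: "(\<lambda>v. \<bar>f v - f z\<bar>) ` P = {1 .. int (card P)}"
    using f graceful_no_neg_iff[OF N] by auto
  have z: "f z = 0 \<or> f z = 1" using bnd low verts_eq by auto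
  have leaf: "0 \<le> f v" "f v \<noteq> f z" if "v \<in> P" for v
    using bnd that vertex_labeling_leaf_neq_centre[OF vl] verts_eq by auto
  show ?thesis
  proof (cases "\<forall>v\<in>P. f z \<le> f v")
    case True
    then have "f ` P = (\<lambda>d. d + f z) ` (\<lambda>v. \<bar>f v - f z\<bar>) ` P"
      by (simp add: image_image cong: image_cong)
    also have "\<dots> = {f z + 1 .. f z + int (card P)}"
      unfolding pos by (subst image_add_atLeastAtMost') (simp add: add.commute)
    finally show ?thesis using minimal z by blast
  next
    case False
    then obtain x where x: "x \<in> P" "f x < f z" by force
    then have z1: "f z = 1" and x0: "f x = 0" using leaf[of x] z by auto
    have "d \<in> f ` P" if "d \<in> {3 .. int (card P) + 1}" for d
    proof -
      have "d - 1 \<in> (\<lambda>v. \<bar>f v - f z\<bar>) ` P" unfolding pos using that by auto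
      then obtain v where v: "v \<in> P" "d - 1 = \<bar>f v - f z\<bar>" by (rule imageE)
      then have "f v = d" using leaf[of v] z1 that by auto
      then show ?thesis using v by blast
    qed
    then have "insert 0 {3 .. int (card P) + 1} \<subseteq> f ` P" using x x0 by force
    \<comment> \<open>The label \<open>2\<close> cannot occur besides: the edge label \<open>1\<close> is already used up by \<open>0\<close>.\<close>
    moreover have "card (insert 0 {3 .. int (card P) + 1}) = card (f ` P)"
      using card_image_pos_neighbours[OF vl] P by simp
    ultimately have "insert 0 {3 .. int (card P) + 1} = f ` P"
      by (intro card_subset_eq) auto
    then show ?thesis using interior z1 by simp
  qed
qed

text \<open>Complementing with respect to \<open>m + 1\<close> and then with respect to \<open>m\<close> lowers all labels by
  \<open>1\<close>, which takes centre \<open>1\<close> with leaves \<open>{2..m + 1}\<close> to centre \<open>0\<close> with leaves \<open>{1..m}\<close>.\<close>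

lemma minimal_centre_labelings_equiv:
  assumes N: "N = {}"
    and f: "f \<in> vertex_labelings S" "f z = 0" "f ` P = {1 .. int (card P)}"
    and g: "g \<in> vertex_labelings S" "g z = 1" "g ` P = {2 .. int (card P) + 1}"
  shows "(g, f) \<in> labeling_equiv S z"
proof -
  define h where "h = complementary_labeling S (int (card P) + 1) g"
  define k where "k = complementary_labeling S (int (card P)) h"
  have bnd: "1 \<le> g v" "g v \<le> int (card P) + 1" if "v \<in> verts S" for v
  proof -
    have "g v = 1 \<or> g v \<in> {2 .. int (card P) + 1}"
      using that g verts_eq N by auto
    then show "1 \<le> g v" "g v \<le> int (card P) + 1" by auto
  qed
  have hv: "h v = int (card P) + 1 - g v" if "v \<in> verts S" for v
    using that unfolding h_def complementary_labeling_def by simp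
  have kv: "k v = g v - 1" if "v \<in> verts S" for v
    using that hv[OF that] unfolding k_def complementary_labeling_def by simp
  have h: "h \<in> vertex_labelings S" and k: "k \<in> vertex_labelings S"
    unfolding k_def h_def using complementary_in_vertex_labelings g(1) by auto
  have "(g, h) \<in> labeling_equiv S z"
    unfolding h_def using bnd by (intro complementary_equiv[OF g(1)]) auto
  moreover have "(h, k) \<in> labeling_equiv S z"
    unfolding k_def using bnd hv by (intro complementary_equiv[OF h]) auto
  moreover have "(k, f) \<in> labeling_equiv S z"
  proof (rule same_labels_equiv[OF k f(1) _ _ N])
    show "k z = f z" using kv verts_eq f g by simp
    have "k ` P = (\<lambda>x. x - 1) ` g ` P"
      using kv verts_eq by (auto simp: image_image intro!: image_cong)
    also have "\<dots> = {1 .. int (card P)}" unfolding g(3) by simp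
    finally show "k ` P = f ` P" using f by simp
  qed
  ultimately show ?thesis unfolding labeling_equiv_def by (meson rtrancl_trans)
qed

lemma two_classes_no_neg:
  assumes N: "N = {}" and P: "card P \<ge> 2"
  shows "card (additively_graceful_labelings S // labeling_equiv S z) = 2"
proof -
  let ?r = "labeling_equiv S z"
  obtain a where a: "a \<in> additively_graceful_labelings S" "a z = 0"
    "a ` P = {1 .. int (card P)}" "extreme_centre S z a"
    using exists_graceful_minimal_centre[OF N] by blast
  obtain b where b: "b \<in> additively_graceful_labelings S" "b z = 1"
    "b ` P = insert 0 {3 .. int (card P) + 1}" "\<not> extreme_centre S z b"
    using exists_graceful_interior_centre[OF N P] by blast
  have vl: "h \<in> vertex_labelings S" if "h \<in> additively_graceful_labelings S" for h
    using that graceful_iff by blast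
  have class_eq: "?r `` {f} = ?r `` {g} \<longleftrightarrow> (f, g) \<in> ?r" for f g
    using equiv_class_eq_iff[OF equiv_labeling_equiv, of f g S z] by simp
  have rep: "?r `` {f} = ?r `` {a} \<or> ?r `` {f} = ?r `` {b}"
    if f: "f \<in> additively_graceful_labelings S" for f
  proof -
    obtain g where g: "g \<in> additively_graceful_labelings S" "(f, g) \<in> ?r" "g z \<le> 1"
      using graceful_no_neg_equiv_low_centre[OF N _ f] P by auto
    have "(g, a) \<in> ?r \<or> (g, b) \<in> ?r"
      using N P g(1,3)
    proof (cases rule: graceful_low_centre_cases)
      case minimal
      then consider "g z = 0" "g ` P = {1 .. int (card P)}"
        | "g z = 1" "g ` P = {2 .. int (card P) + 1}"
        by (auto simp: add.commute)
      then show ?thesis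
      proof cases
        case 1
        then show ?thesis using same_labels_equiv[OF vl[OF g(1)] vl[OF a(1)]] a N by simp
      next
        case 2
        then show ?thesis
          using minimal_centre_labelings_equiv[OF N vl[OF a(1)] a(2,3) vl[OF g(1)]] by simp
      qed
    next
      case interior
      then show ?thesis using same_labels_equiv[OF vl[OF g(1)] vl[OF b(1)]] b N by simp
    qed
    then show ?thesis using g(2) class_eq by metis
  qed
  have "additively_graceful_labelings S // ?r = {?r `` {a}, ?r `` {b}}"
    using rep a(1) b(1) unfolding quotient_def by blast
  moreover have "?r `` {a} \<noteq> ?r `` {b}"
    using class_eq extreme_centre_equiv a(4) b(4) by blast
  ultimately show ?thesis by simp
qed

end

section \<open>The classification\<close>

theorem theorem2p4:
  fixes S :: "'a sgraph" and z :: 'a and p m n k :: nat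
  assumes "pmn_signed_graph S p m n"
    and "star_with_centre S k z"
  shows "(additively_graceful S \<longleftrightarrow> n = 0 \<or> n = 1 \<or> negative_P3 S) \<and>
    ((n = 1 \<or> n = 2) \<and> additively_graceful S \<longrightarrow>
       (\<forall>f \<in> additively_graceful_labelings S. \<forall>g \<in> additively_graceful_labelings S.
          \<exists>z'. star_with_centre S k z' \<and> rearranged S z f z' g)) \<and>
    (n = 0 \<and> m \<ge> 2 \<longrightarrow>
       card (additively_graceful_labelings S // labeling_equiv S z) = 2)"
proof -
  have sg: "signed_graph S" using assms(1) unfolding pmn_signed_graph_def by simp
  interpret signed_star S z
    by (rule signed_star_of_star_with_centre(1)[OF sg assms(2)])
  have k: "k = card P + card N"
    by (rule signed_star_of_star_with_centre(2)[OF sg assms(2)])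
  have m: "m = card P" and n: "n = card N"
    using assms(1) card_pos_edges card_neg_edges unfolding pmn_signed_graph_def by auto
  have "additively_graceful S" if "n = 0"
    using that n exists_graceful_minimal_centre unfolding additively_graceful_def
    by (metis neg_neighbours_empty)
  moreover have "n = 0 \<or> n = 1 \<or> negative_P3 S" if gr: "additively_graceful S"
  proof -
    have "negative_P3 S" if "n \<ge> 2"
      using gr that graceful_two_neg n negative_P3_iff unfolding additively_graceful_def by blast
    then show ?thesis by linarith
  qed
  ultimately have part1: "additively_graceful S \<longleftrightarrow> n = 0 \<or> n = 1 \<or> negative_P3 S"
    using exists_graceful_one_neg exists_graceful_two_neg negative_P3_iff n by metis
  have part2: "\<exists>z'. star_with_centre S k z' \<and> rearranged S z f z' g"
    if n12: "n = 1 \<or> n = 2" and f: "f \<in> additively_graceful_labelings S"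
      and g: "g \<in> additively_graceful_labelings S" for f g
  proof (cases "n = 1 \<and> P = {}")
    case True
    then show ?thesis
      using single_negative_edge_labelings_rearranged[OF f g] k n by simp
  next
    case False
    have "f z = g z \<and> f ` P = g ` P \<and> f ` N = g ` N"
    proof (cases "n = 1")
      case True
      then show ?thesis using graceful_one_neg[OF f] graceful_one_neg[OF g] False n by simp
    next
      case False
      then show ?thesis using graceful_two_neg[OF f] graceful_two_neg[OF g] n12 n by simp
    qed
    then have "rearranged S z f z g"
      using f g by (intro rearranged_if_same_labels) (simp_all add: graceful_iff)
    then show ?thesis using assms(2) by blast
  qed
  show ?thesis
    using part1 part2 two_classes_no_neg m n by auto
qed

end
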